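(* Let $n$ be a positive integer. If $T$ is a minimal element of $\mathcal{T}_n$ under the partial order $\leq_t$, then $T$ has no vertex of degree at least $3$.
   Context: For a graph $X$, $A(X)$ denotes its adjacency matrix. A tree $T$ is invertible if $A(T)$ is invertible; equivalently, $T$ has a perfect matching, which is then unique and denoted $M$. Edges of $M$ are called matching edges and all other edges are non-matching edges. $\mathcal{T}_n$ denotes the class of invertible trees on $2n$ vertices, considered up to isomorphism. The inverse graph $T^{-1}$ of an invertible tree $T$ is the graph on vertex set $V(T)$ in which distinct vertices $a,b$ are adjacent if and only if $(A(T)^{-1})_{a,b}\neq 0$ (the matrix $A(T)^{-1}$ has zero diagonal and entries in $\{0,\pm1\}$). Let $\phi$ be the involution of $V(T)$ that swaps the two ends of every edge of $M$; for a pair $e=uv$ write $\phi(e)=\phi(u)\phi(v)$, and let $\phi(T)$ be the tree on $V(T)$ with edge set $\{\phi(g): g\in E(T)\}$; it is a subgraph of $T^{-1}$. Tree-exchange: suppose $T^{-1}$ contains an edge $e\notin E(\phi(T))$ (so $\phi(e)\notin E(T)$). Let $f\in E(T)$ be any non-matching edge of $T$ lying on the fundamental cycle of $\phi(e)$, i.e. the unique cycle of $T\cup\{\phi(e)\}$. Let $\tau(T,e,f)$ be the tree obtained from $T$ by adding the edge $\phi(e)$ and removing the edge $f$; the set $M$ is also a perfect matching of $\tau(T,e,f)$. A tree $\widetilde{T}$ is obtained from $T$ by tree-exchange if $\widetilde{T}=\tau(T,e,f)$ for some such $e$ and $f$. The relation $\leq_t$ on $\mathcal{T}_n$ is the transitive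 closure of the relation given by: (a) $T\leq_t T$ for all $T\in\mathcal{T}_n$; and (b) $T\leq_t\widetilde{T}$ if $\widetilde{T}$ is isomorphic to a tree obtained from $T$ by tree-exchange. It is a partial order on $\mathcal{T}_n$. *)

theory Defs
  imports "HOL-Analysis.Analysis"
begin

(* A graph on the vertex set UNIV :: 'v set is identified with its set of edges, each edge
   being the two-element set of its ends. *)

type_synonym 'v graph = "'v set set"

definition simple_graph :: "'v graph \<Rightarrow> bool" where
  "simple_graph E \<longleftrightarrow> (\<forall>e\<in>E. card e = 2)"

definition vertex_degree :: "'v graph \<Rightarrow> 'v \<Rightarrow> nat" where
  "vertex_degree E v = card {w. {v, w} \<in> E}"

definition connected_graph :: "'v graph \<Rightarrow> bool" where
  "connected_graph E \<longleftrightarrow> (\<forall>u v. (u, v) \<in> {(x, y). {x, y} \<in> E}\<^sup>*)"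

(* A cycle is given by the list of its vertices in cyclic order; the starting point and the
   direction are immaterial. *)

definition cycle_edges :: "'v list \<Rightarrow> 'v graph" where
  "cycle_edges p = {{p ! i, p ! (Suc i mod length p)} | i. i < length p}"

definition is_cycle :: "'v graph \<Rightarrow> 'v list \<Rightarrow> bool" where
  "is_cycle E p \<longleftrightarrow> 3 \<le> length p \<and> distinct p \<and> cycle_edges p \<subseteq> E"

definition tree :: "'v graph \<Rightarrow> bool" where
  "tree E \<longleftrightarrow> simple_graph E \<and> connected_graph E \<and> (\<nexists>p. is_cycle E p)"

definition isomorphic :: "'v graph \<Rightarrow> 'v graph \<Rightarrow> bool" where
  "isomorphic E F \<longleftrightarrow> (\<exists>h. bij h \<and> F = (\<lambda>e. h ` e) ` E)"

definition adjacency_matrix :: "'v::finite graph \<Rightarrow> real ^ 'v ^ 'v" where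
  "adjacency_matrix E = (\<chi> a b. if {a, b} \<in> E then 1 else 0)"

(* Representatives, on the vertex set UNIV :: 'v set, of the isomorphism classes of invertible
   trees on 2n vertices; the set is empty unless 'v has exactly 2n elements. Equality of
   isomorphism classes is the relation isomorphic. *)

definition invertible_trees :: "nat \<Rightarrow> 'v::finite graph set" where
  "invertible_trees n = {T. CARD('v) = 2 * n \<and> tree T \<and> invertible (adjacency_matrix T)}"

definition inverse_graph :: "'v::finite graph \<Rightarrow> 'v graph" where
  "inverse_graph T = {{a, b} | a b. a \<noteq> b \<and> matrix_inv (adjacency_matrix T) $ a $ b \<noteq> 0}"

definition perfect_matching :: "'v graph \<Rightarrow> 'v graph \<Rightarrow> bool" where
  "perfect_matching E M \<longleftrightarrow> M \<subseteq> E \<and> (\<forall>v. \<exists>!e. e \<in> M \<and> v \<in> e)"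

(* Meaningful for invertible trees, which have exactly one perfect matching. *)

definition matching :: "'v graph \<Rightarrow> 'v graph" where
  "matching T = (THE M. perfect_matching T M)"

(* mate T is the involution \<open>\<phi>\<close> and mate_tree T is \<open>\<phi>(T)\<close>. *)

definition mate :: "'v graph \<Rightarrow> 'v \<Rightarrow> 'v" where
  "mate T v = (THE w. {v, w} \<in> matching T)"

definition mate_tree :: "'v graph \<Rightarrow> 'v graph" where
  "mate_tree T = (\<lambda>g. mate T ` g) ` T"

(* This is \<open>\<tau>(T, e, f)\<close>; f is an edge of T, so it differs from the added edge \<open>\<phi>(e)\<close>. *)

definition exchange :: "'v graph \<Rightarrow> 'v set \<Rightarrow> 'v set \<Rightarrow> 'v graph" where
  "exchange T e f = insert (mate T ` e) T - {f}"

(* If T is a tree and g is not an edge of T, all cycles p of T with g added have the same set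
   of edges, that of the fundamental cycle of g. *)

definition on_fundamental_cycle :: "'v graph \<Rightarrow> 'v set \<Rightarrow> 'v set \<Rightarrow> bool" where
  "on_fundamental_cycle T g f \<longleftrightarrow> (\<exists>p. is_cycle (insert g T) p \<and> f \<in> cycle_edges p)"

definition tree_exchange :: "'v::finite graph \<Rightarrow> 'v graph \<Rightarrow> bool" where
  "tree_exchange T S \<longleftrightarrow>
     (\<exists>e f. e \<in> inverse_graph T \<and> e \<notin> mate_tree T \<and>
            f \<in> T \<and> f \<notin> matching T \<and> on_fundamental_cycle T (mate T ` e) f \<and>
            S = exchange T e f)"

definition exchange_step :: "nat \<Rightarrow> 'v::finite graph \<Rightarrow> 'v graph \<Rightarrow> bool" where
  "exchange_step n T S \<longleftrightarrow>
     T \<in> invertible_trees n \<and> S \<in> invertible_trees n \<and>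
     (isomorphic T S \<or> (\<exists>S'. tree_exchange T S' \<and> isomorphic S' S))"

definition leq_t :: "nat \<Rightarrow> 'v::finite graph \<Rightarrow> 'v graph \<Rightarrow> bool" where
  "leq_t n = (exchange_step n)\<^sup>+\<^sup>+"

definition minimal_tree :: "nat \<Rightarrow> 'v::finite graph \<Rightarrow> bool" where
  "minimal_tree n T \<longleftrightarrow>
     T \<in> invertible_trees n \<and> (\<forall>S\<in>invertible_trees n. leq_t n S T \<longrightarrow> isomorphic S T)"

end

theory Submission
  imports Defs
begin

text \<open>
  Write \<open>\<phi>\<close> for the involution that swaps the ends of every matching edge, and suppose that \<open>u\<close> has
  degree at least 3 in the invertible tree \<open>T\<close>. Then \<open>u\<close> has two neighbours \<open>v\<close> and \<open>a\<close> other than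
  \<open>\<phi> u\<close>. Cut the non-matching edge \<open>uv\<close>, and from \<open>\<phi> u, u\<close> follow, inside the component of \<open>u\<close>, a
  path whose edges alternate between matching and non-matching ones, ending with a matching edge,
  until it cannot be prolonged (\<open>maximal_alternating\<close>). Its last vertex \<open>x\<close> is a leaf of \<open>T\<close>, and
  \<open>x \<noteq> u\<close> because \<open>a\<close> offers a continuation at \<open>u\<close>. Let \<open>S\<close> be \<open>T\<close> with the edge \<open>uv\<close> replaced by
  \<open>xv\<close>, that is, the branch at \<open>v\<close> is moved from \<open>u\<close> to the leaf \<open>x\<close>.

  In \<open>S\<close> the alternating path continues through \<open>v\<close> to \<open>\<phi> v\<close>, so \<open>\<phi> u\<close> and \<open>\<phi> v\<close> are adjacent in the
  inverse graph of \<open>S\<close> (\<open>alternating_in_inverse_graph\<close>), and the fundamental cycle of \<open>uv\<close> in \<open>S\<close>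
  contains \<open>xv\<close> (\<open>alternating_cycle\<close>). Hence \<open>T\<close> arises from \<open>S\<close> by a tree-exchange and \<open>S\<close> lies
  below \<open>T\<close>. But \<open>S\<close> has exactly one leaf fewer than \<open>T\<close>: the leaf \<open>x\<close> becomes a vertex of degree 2,
  while \<open>u\<close> keeps degree at least 2. So \<open>S\<close> and \<open>T\<close> are not isomorphic, and \<open>T\<close> is not minimal.

  The facts about perfect matchings and the inverse matrix all come from one principle: in a finite
  forest a walk that never turns straight back cannot go on forever
  (\<open>no_unbounded_nonbacktracking\<close>). A permutation that moves every vertex along an edge and is not
  an involution, two different perfect matchings, or an unwanted nonzero entry in a solution of a
  linear system with the adjacency matrix would each produce such an endless walk.
\<close>

section \<open>Non-backtracking walks in forests\<close>

definition forest :: "'v graph \<Rightarrow> bool" where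
  "forest E \<longleftrightarrow> simple_graph E \<and> (\<nexists>p. is_cycle E p)"

lemma simple_graph_ends: "simple_graph E \<Longrightarrow> {a, b} \<in> E \<Longrightarrow> a \<noteq> b"
  unfolding simple_graph_def by fastforce

lemma cycle_of_closed_path:
  assumes "3 \<le> length p" "distinct p" "successively (\<lambda>a b. {a, b} \<in> E) p" "{last p, hd p} \<in> E"
  shows "is_cycle E p"
proof -
  have "{p ! i, p ! (Suc i mod length p)} \<in> E" if i: "i < length p" for i
  proof (cases "Suc i < length p")
    case True
    then show ?thesis using assms(3) by (auto simp: successively_conv_nth)
  next
    case False
    with i have "Suc i = length p" by simp
    then show ?thesis using assms(1,4)
      by (metis diff_Suc_1 hd_conv_nth last_conv_nth list.size(3) mod_self nat.distinct(1))
  qed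
  then show ?thesis using assms unfolding is_cycle_def cycle_edges_def by auto
qed

text \<open>
  The most recent vertex of the walk is the head of the list, so that prolonging the walk is a Cons.
\<close>

fun nonbacktracking :: "'v graph \<Rightarrow> 'v list \<Rightarrow> bool" where
  "nonbacktracking E (x # y # L) \<longleftrightarrow>
     {x, y} \<in> E \<and> (L \<noteq> [] \<longrightarrow> hd L \<noteq> x) \<and> nonbacktracking E (y # L)"
| "nonbacktracking E _ \<longleftrightarrow> True"

lemma nonbacktracking_mono: "nonbacktracking E L \<Longrightarrow> E \<subseteq> F \<Longrightarrow> nonbacktracking F L"
  by (induction E L rule: nonbacktracking.induct) auto

lemma nonbacktracking_successively:
  "nonbacktracking E L \<Longrightarrow> successively (\<lambda>a b. {a, b} \<in> E) L"
  by (induction E L rule: nonbacktracking.induct) auto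

lemma nonbacktracking_Cons: "nonbacktracking E (x # L) \<Longrightarrow> nonbacktracking E L"
  by (cases L) auto

text \<open>
  Between two consecutive visits to the same vertex the walk would run through a cycle: it has length
  at least 3 because there are no loops and the walk does not turn back after one step.
\<close>

lemma nonbacktracking_distinct:
  assumes "forest E" "nonbacktracking E L"
  shows "distinct L"
  using assms(2)
proof (induction L)
  case (Cons x L)
  then have L: "distinct L" using nonbacktracking_Cons[of E x L] by simp
  have "x \<notin> set L"
  proof
    assume "x \<in> set L"
    then obtain A B where AB: "L = A @ x # B" by (meson split_list)
    have simple: "simple_graph E" using assms(1) by (simp add: forest_def)
    have succ: "successively (\<lambda>a b. {a, b} \<in> E) (x # A @ x # B)"
      using nonbacktracking_successively[OF Cons.prems] AB by simp
    have "A \<noteq> []" using succ simple_graph_ends[OF simple, of x x] by auto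
    moreover have "tl A \<noteq> []"
    proof
      assume "tl A = []"
      then obtain y where "A = [y]" using \<open>A \<noteq> []\<close> by (cases A) auto
      then show False using Cons.prems AB by simp
    qed
    ultimately have len: "3 \<le> length (x # A)"
      by (cases A; cases "tl A") auto
    have "successively (\<lambda>a b. {a, b} \<in> E) ((x # A) @ (x # B))" using succ by simp
    then have "successively (\<lambda>a b. {a, b} \<in> E) (x # A)" "{last (x # A), x} \<in> E"
      unfolding successively_append_iff by auto
    then have "is_cycle E (x # A)"
      using len L AB by (intro cycle_of_closed_path) auto
    then show False using assms(1) by (auto simp: forest_def)
  qed
  with L show ?case by simp
qed simp

text \<open>
  The form in which the absence of endless walks is used: a nonempty family of walks in which every
  member can be prolonged within the family contradicts the bound that the number of vertices puts on
  the length of a list of distinct vertices.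
\<close>

lemma no_unbounded_nonbacktracking:
  fixes E :: "'v::finite graph"
  assumes "forest E" "L \<in> Q"
    and "\<And>L. L \<in> Q \<Longrightarrow> nonbacktracking E L"
    and "\<And>L. L \<in> Q \<Longrightarrow> \<exists>K\<in>Q. length L < length K"
  shows False
proof -
  have "\<exists>K\<in>Q. n \<le> length K" for n
    using assms(2,4) by (induction n) (auto, metis Suc_leI le_trans not_less_eq_eq)
  then obtain K where K: "K \<in> Q" "Suc CARD('v) \<le> length K" by blast
  then have "distinct K" using assms(1,3) nonbacktracking_distinct by blast
  then have "length K \<le> CARD('v)"
    by (metis card_mono distinct_card finite_class.finite_UNIV top_greatest)
  with K(2) show False by simp
qed

section \<open>Forests are the graphs in which every edge is a bridge\<close>

definition joined :: "'v graph \<Rightarrow> ('v \<times> 'v) set" where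
  "joined E = {(x, y). {x, y} \<in> E}\<^sup>*"

lemma joined_refl [simp]: "(a, a) \<in> joined E"
  by (simp add: joined_def)

lemma joined_trans: "(a, b) \<in> joined E \<Longrightarrow> (b, c) \<in> joined E \<Longrightarrow> (a, c) \<in> joined E"
  unfolding joined_def by (rule rtrancl_trans)

lemma joined_sym: "(a, b) \<in> joined E \<Longrightarrow> (b, a) \<in> joined E"
  unfolding joined_def by (rule symD[OF sym_rtrancl]) (auto simp: sym_def insert_commute)

lemma joined_edge: "{a, b} \<in> E \<Longrightarrow> (a, b) \<in> joined E"
  unfolding joined_def by auto

lemma joined_mono: "(a, b) \<in> joined E \<Longrightarrow> E \<subseteq> F \<Longrightarrow> (a, b) \<in> joined F"
  unfolding joined_def by (erule rtrancl_mono[THEN subsetD, rotated]) auto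

lemma joined_insert:
  assumes "(a, b) \<in> joined (insert {x, y} E)"
  shows "(a, b) \<in> joined E \<or> (a, x) \<in> joined E \<and> (y, b) \<in> joined E
         \<or> (a, y) \<in> joined E \<and> (x, b) \<in> joined E"
  using assms[unfolded joined_def]
proof (induction rule: rtrancl_induct)
  case (step b c)
  consider "{b, c} \<in> E" | "b = x" "c = y" | "b = y" "c = x"
    using step.hyps(2) by (auto simp: doubleton_eq_iff)
  then show ?case
  proof cases
    case 1
    then have "(b, c) \<in> joined E" by (rule joined_edge)
    then show ?thesis using step.IH by (meson joined_trans)
  qed (use step.IH in \<open>auto intro: joined_sym joined_trans\<close>)
qed simp

text \<open>
  A walk is reduced as it is built: a step that would turn back cancels the step before it.
\<close>

lemma joined_nonbacktracking:
  assumes "(a, b) \<in> joined E"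
  shows "\<exists>L. L \<noteq> [] \<and> hd L = b \<and> last L = a \<and> nonbacktracking E L"
  using assms[unfolded joined_def]
proof (induction rule: rtrancl_induct)
  case base
  show ?case by (rule exI[of _ "[a]"]) simp
next
  case (step b c)
  then obtain L where L: "hd (b # L) = b" "last (b # L) = a" "nonbacktracking E (b # L)"
    by (metis list.collapse)
  show ?case
  proof (cases "L \<noteq> [] \<and> hd L = c")
    case True
    then show ?thesis using L by (intro exI[of _ L]) (auto dest: nonbacktracking_Cons)
  next
    case False
    then show ?thesis using L step.hyps by (intro exI[of _ "c # b # L"]) (auto simp: insert_commute)
  qed
qed

text \<open>
  An edge that is not a bridge is closed up to a repetition by a reduced walk between its ends, and
  an edge of a cycle is bypassed by the rest of the cycle. The bridge form of acyclicity is the one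
  that behaves well when an edge is replaced.
\<close>

lemma forest_iff_bridges:
  assumes "simple_graph E"
  shows "forest E \<longleftrightarrow> (\<forall>x y. {x, y} \<in> E \<longrightarrow> (x, y) \<notin> joined (E - {{x, y}}))"
proof (intro iffI allI impI notI)
  fix x y assume E: "forest E" "{x, y} \<in> E" and j: "(x, y) \<in> joined (E - {{x, y}})"
  have "x \<noteq> y" using simple_graph_ends[OF assms E(2)] .
  from joined_nonbacktracking[OF j] obtain L where
    L: "L \<noteq> []" "hd L = y" "last L = x" "nonbacktracking (E - {{x, y}}) L" by blast
  with \<open>x \<noteq> y\<close> obtain q R where R: "L = y # q # R"
    by (metis last_ConsL list.exhaust_sel)
  have "q \<noteq> x" using L(4) R by (auto simp: insert_commute)
  moreover have "nonbacktracking E L" using nonbacktracking_mono[OF L(4)] by blast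
  ultimately have "nonbacktracking E (x # L)" using E(2) R by simp
  then have "distinct (x # L)" using nonbacktracking_distinct E(1) by blast
  moreover have "x \<in> set L" using L(1,3) last_in_set by blast
  ultimately show False by simp
next
  assume B: "\<forall>x y. {x, y} \<in> E \<longrightarrow> (x, y) \<notin> joined (E - {{x, y}})"
  have False if cyc: "is_cycle E p" for p
  proof -
    let ?F = "E - {{p ! 0, p ! 1}}"
    have len: "3 \<le> length p" and dist: "distinct p"
      and edge: "\<And>i. i < length p \<Longrightarrow> {p ! i, p ! (Suc i mod length p)} \<in> E"
      using cyc unfolding is_cycle_def cycle_edges_def by auto
    have path: "(p ! 1, p ! Suc k) \<in> joined ?F" if "Suc k < length p" for k
      using that
    proof (induction k)
      case (Suc k)
      have "{p ! Suc k, p ! Suc (Suc k)} \<in> E"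
        using edge[of "Suc k"] Suc.prems by simp
      moreover have "p ! Suc k \<noteq> p ! 0" "p ! Suc (Suc k) \<noteq> p ! 0"
        using dist Suc.prems len
        by (metis Suc_lessD Zero_not_Suc gr_implies_not0 nat_neq_iff nth_eq_iff_index_eq)+
      ultimately have "{p ! Suc k, p ! Suc (Suc k)} \<in> ?F"
        by (auto simp: doubleton_eq_iff)
      then show ?case using Suc by (meson Suc_lessD joined_edge joined_trans)
    qed simp
    obtain m where m: "length p = Suc (Suc m)" "m \<ge> 1"
      using len by (metis add_2_eq_Suc le_Suc_ex numeral_3_eq_3 add_Suc plus_1_eq_Suc le_add1)
    have "{p ! Suc m, p ! 0} \<in> E" using edge[of "Suc m"] m by simp
    moreover have "p ! Suc m \<noteq> p ! 1" "p ! 0 \<noteq> p ! 1"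
      using dist m by (auto simp: nth_eq_iff_index_eq)
    ultimately have "{p ! Suc m, p ! 0} \<in> ?F" by (auto simp: doubleton_eq_iff)
    then have "(p ! 1, p ! 0) \<in> joined ?F"
      using path[of m] m(1) by (metis joined_edge lessI joined_trans)
    moreover have "{p ! 0, p ! 1} \<in> E" using edge[of 0] m by simp
    ultimately show False using B joined_sym[of "p ! 1" "p ! 0" ?F] by simp
  qed
  then show "forest E" using assms by (auto simp: forest_def)
qed

section \<open>The perfect matching as an involution\<close>

definition matching_involution :: "'v graph \<Rightarrow> ('v \<Rightarrow> 'v) \<Rightarrow> bool" where
  "matching_involution E \<phi> \<longleftrightarrow> (\<forall>v. {v, \<phi> v} \<in> E \<and> \<phi> (\<phi> v) = v)"

text \<open>
  Where two matchings differ, steps along the one and the other can be taken in turn; they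
  differ again at the vertex reached, so this walk never ends and never turns back.
\<close>

lemma matching_involution_unique:
  fixes E :: "'v::finite graph"
  assumes E: "forest E" and \<phi>: "matching_involution E \<phi>" and \<psi>: "matching_involution E \<psi>"
  shows "\<phi> = \<psi>"
proof (rule ccontr)
  assume "\<phi> \<noteq> \<psi>"
  then obtain u where u: "\<phi> u \<noteq> \<psi> u" by blast
  let ?Q = "{L. nonbacktracking E L \<and> (\<exists>x y R. L = y # x # R \<and> \<phi> x \<noteq> \<psi> x \<and> (y = \<phi> x \<or> y = \<psi> x))}"
  have "[\<phi> u, u] \<in> ?Q" using \<phi> u by (auto simp: matching_involution_def insert_commute)
  then show False
  proof (rule no_unbounded_nonbacktracking[OF E])
    fix L assume "L \<in> ?Q"
    then show "nonbacktracking E L" by simp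
  next
    fix L assume "L \<in> ?Q"
    then obtain x y R where L: "L = y # x # R" "nonbacktracking E L" "\<phi> x \<noteq> \<psi> x" "y = \<phi> x \<or> y = \<psi> x"
      by blast
    define z where "z = (if y = \<phi> x then \<psi> y else \<phi> y)"
    have "\<phi> y \<noteq> \<psi> y" "z \<noteq> x" using L \<phi> \<psi> unfolding matching_involution_def z_def by (metis, metis)
    moreover have "{z, y} \<in> E" "z = \<phi> y \<or> z = \<psi> y"
      using \<phi> \<psi> unfolding matching_involution_def z_def by (auto simp: insert_commute)
    ultimately have "z # L \<in> ?Q" using L by auto
    then show "\<exists>K\<in>?Q. length L < length K" by (rule bexI[rotated]) simp
  qed
qed

text \<open>
  Identifies the definite descriptions behind \<^const>\<open>matching\<close> and \<^const>\<open>mate\<close>; every perfect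
  matching has an involution of its own, to which uniqueness applies.
\<close>

lemma matching_of_involution:
  fixes E :: "'v::finite graph"
  assumes E: "forest E" and \<phi>: "matching_involution E \<phi>"
  shows "matching E = {{v, \<phi> v} | v. True}" and "mate E = \<phi>"
proof -
  let ?M = "{{v, \<phi> v} | v. True}"
  have inv: "\<And>v. \<phi> (\<phi> v) = v" and edge: "\<And>v. {v, \<phi> v} \<in> E"
    using \<phi> by (auto simp: matching_involution_def)
  have mem: "{v, w} \<in> ?M \<longleftrightarrow> w = \<phi> v" for v w
    using inv by (auto simp: doubleton_eq_iff)
  have at: "e = {v, \<phi> v}" if "e \<in> ?M" "v \<in> e" for e v
    using that inv by auto
  then have pm: "perfect_matching E ?M"
    unfolding perfect_matching_def
  proof (intro conjI allI)
    show "?M \<subseteq> E" using edge by auto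
    show "\<exists>!e. e \<in> ?M \<and> v \<in> e" for v
      by (rule ex1I[of _ "{v, \<phi> v}"]) (blast, elim conjE, rule at)
  qed
  have "N = ?M" if N: "perfect_matching E N" for N
  proof -
    have "N \<subseteq> E" and one: "\<forall>v. \<exists>!e. e \<in> N \<and> v \<in> e"
      using N unfolding perfect_matching_def by (rule conjunct1, rule conjunct2)
    have card2: "card e = 2" if "e \<in> N" for e
    proof -
      have "e \<in> E" using that \<open>N \<subseteq> E\<close> by (rule subsetD[rotated])
      then show ?thesis using E by (simp add: forest_def simple_graph_def)
    qed
    have two: "\<exists>w. e = {v, w}" if "e \<in> N" "v \<in> e" for e v
      using card2[OF that(1)] that(2) by (auto simp: card_2_iff)
    have ex: "\<exists>w. {v, w} \<in> N" for v
    proof -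
      obtain e where "e \<in> N" "v \<in> e" using one[THEN spec, of v] by (elim ex1E conjE)
      then show ?thesis using two by blast
    qed
    have uniq: "w = w'" if "{v, w} \<in> N" "{v, w'} \<in> N" for v w w'
    proof -
      have "{v, w} = {v, w'}" using one[THEN spec, of v] by (rule ex1E) (use that in blast)
      then show ?thesis by (auto simp: doubleton_eq_iff)
    qed
    obtain \<psi> where \<psi>: "\<And>v. {v, \<psi> v} \<in> N" using ex by metis
    have "matching_involution E \<psi>"
      unfolding matching_involution_def
    proof (intro allI conjI)
      fix v
      show "{v, \<psi> v} \<in> E" using \<psi> \<open>N \<subseteq> E\<close> by blast
      show "\<psi> (\<psi> v) = v"
        using uniq[OF \<psi>[of "\<psi> v"], of v] \<psi>[of v] by (simp add: insert_commute)
    qed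
    then have "\<psi> = \<phi>" using matching_involution_unique E \<phi> by blast
    with \<psi> have sub: "?M \<subseteq> N" by auto
    moreover have "e \<in> ?M" if e: "e \<in> N" for e
    proof -
      obtain v w where "e = {v, w}" using card2[OF e] by (auto simp: card_2_iff)
      moreover from this have "w = \<phi> v" using uniq e \<psi>[of v] \<open>\<psi> = \<phi>\<close> by blast
      ultimately show ?thesis by blast
    qed
    ultimately show ?thesis by blast
  qed
  with pm show M: "matching E = ?M" unfolding matching_def by (rule the_equality)
  show "mate E = \<phi>"
    unfolding mate_def M mem by simp
qed

section \<open>Linear systems with the adjacency matrix of a forest\<close>

lemma adjacency_matrix_row:
  fixes E :: "'v::finite graph" and z :: "'v \<Rightarrow> real"
  shows "(\<Sum>w\<in>UNIV. adjacency_matrix E $ r $ w * z w) = (\<Sum>w | {r, w} \<in> E. z w)"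
  by (intro sum.mono_neutral_cong_right) (auto simp: adjacency_matrix_def)

lemma other_nonzero_neighbour:
  fixes E :: "'v::finite graph" and z :: "'v \<Rightarrow> real"
  assumes "(\<Sum>w | {r, w} \<in> E. z w) = 0" "{r, d} \<in> E" "z d \<noteq> 0"
  obtains c where "{r, c} \<in> E" "c \<noteq> d" "z c \<noteq> 0"
proof -
  have "(\<Sum>w | {r, w} \<in> E. z w) = z d + (\<Sum>w \<in> {w. {r, w} \<in> E} - {d}. z w)"
    using assms(2) by (intro sum.remove) auto
  then have "(\<Sum>w \<in> {w. {r, w} \<in> E} - {d}. z w) \<noteq> 0" using assms by linarith
  then obtain c where "c \<in> {w. {r, w} \<in> E} - {d}" "z c \<noteq> 0" by (meson sum.neutral)
  then show ?thesis using that by blast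
qed

text \<open>
  The equation of row \<open>\<phi> c\<close> says that the values at the neighbours of \<open>\<phi> c\<close> sum to 0, so a nonzero value
  at \<open>c\<close> forces a nonzero value at another neighbour \<open>d\<close>. Then \<open>\<phi> d\<close> takes the place of \<open>\<phi> c\<close>, and so on.
  The exceptional row \<open>b\<close> could stop this only if the walk came to \<open>b\<close>, which is impossible once it
  has passed through \<open>b\<close>, as walks in a forest do not return.
\<close>

lemma support_not_escaping:
  fixes E :: "'v::finite graph" and z :: "'v \<Rightarrow> real"
  assumes E: "forest E" and \<phi>: "matching_involution E \<phi>"
    and rows: "\<And>r. r \<noteq> b \<Longrightarrow> (\<Sum>w | {r, w} \<in> E. z w) = 0"
    and L: "nonbacktracking E (\<phi> c # c # R)" "b \<in> set (c # R)"
  shows "z c = 0"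
proof (rule ccontr)
  assume "z c \<noteq> 0"
  let ?Q = "{L. nonbacktracking E L \<and> (\<exists>c R. L = \<phi> c # c # R \<and> b \<in> set (c # R) \<and> z c \<noteq> 0)}"
  have inv: "\<And>v. \<phi> (\<phi> v) = v" and edge: "\<And>v. {v, \<phi> v} \<in> E"
    using \<phi> by (auto simp: matching_involution_def)
  have "\<phi> c # c # R \<in> ?Q" using L \<open>z c \<noteq> 0\<close> by blast
  then show False
  proof (rule no_unbounded_nonbacktracking[OF E])
    fix L assume "L \<in> ?Q"
    then show "nonbacktracking E L" by simp
  next
    fix L assume "L \<in> ?Q"
    then obtain c R where L: "L = \<phi> c # c # R" "nonbacktracking E L" "b \<in> set (c # R)" "z c \<noteq> 0"
      by blast
    have "distinct L" using nonbacktracking_distinct[OF E L(2)] .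
    then have "\<phi> c \<noteq> b" using L(1,3) by auto
    moreover have "{\<phi> c, c} \<in> E" using edge by (metis insert_commute)
    ultimately obtain d where d: "{\<phi> c, d} \<in> E" "d \<noteq> c" "z d \<noteq> 0"
      using other_nonzero_neighbour[OF rows _ L(4)] by metis
    have "\<phi> d \<noteq> \<phi> c" using inv d(2) by metis
    then have "\<phi> d # d # L \<in> ?Q"
      using d L edge[of d] by (auto simp: insert_commute)
    then show "\<exists>K\<in>?Q. length L < length K" by (rule bexI[rotated]) simp
  qed
qed

text \<open>
  The kernel is trivial: a homogeneous system has no exceptional row, so the walk of
  \<open>support_not_escaping\<close> may begin at any vertex in the support.
\<close>

lemma invertible_if_matching_involution:
  fixes E :: "'v::finite graph"
  assumes E: "forest E" and \<phi>: "matching_involution E \<phi>"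
  shows "invertible (adjacency_matrix E)"
proof -
  have inv: "\<And>v. \<phi> (\<phi> v) = v" and edge: "\<And>v. {v, \<phi> v} \<in> E"
    using \<phi> by (auto simp: matching_involution_def)
  have "x = 0" if x: "adjacency_matrix E *v x = 0" for x :: "real ^ 'v"
  proof -
    have rows: "(\<Sum>w | {r, w} \<in> E. x $ w) = 0" for r
    proof -
      have "(adjacency_matrix E *v x) $ r = 0" using x by simp
      then show ?thesis by (simp add: matrix_vector_mult_def adjacency_matrix_row)
    qed
    have "x $ c = 0" for c
      using support_not_escaping[OF E \<phi>, of c "\<lambda>w. x $ w" c "[]"] rows edge[of c]
      by (simp add: insert_commute)
    then show ?thesis by (simp add: vec_eq_iff)
  qed
  then show ?thesis
    by (simp add: invertible_left_inverse matrix_left_invertible_ker)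
qed

text \<open>
  A nonzero term of the Leibniz formula is a permutation that moves every vertex along an edge. In a
  forest such a permutation only swaps pairs, since the orbit of a vertex with \<open>p (p v) \<noteq> v\<close> is a
  walk that never turns back.
\<close>

lemma matching_involution_if_invertible:
  fixes E :: "'v::finite graph"
  assumes E: "forest E" and A: "invertible (adjacency_matrix E)"
  obtains \<phi> where "matching_involution E \<phi>"
proof -
  have "det (adjacency_matrix E) \<noteq> 0" using A by (simp add: invertible_det_nz)
  then obtain p where p: "p permutes UNIV" "(\<Prod>i\<in>UNIV. adjacency_matrix E $ i $ p i) \<noteq> 0"
    unfolding det_def by (metis (no_types, lifting) mem_Collect_eq mult_zero_right sum.neutral)
  then have edge: "{v, p v} \<in> E" for v
    by (auto simp: adjacency_matrix_def split: if_splits)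
  have inj: "p a = p b \<Longrightarrow> a = b" for a b using permutes_inj[OF p(1)] by (simp add: inj_def)
  have "p (p v) = v" for v
  proof (rule ccontr)
    assume v: "p (p v) \<noteq> v"
    let ?Q = "{L. nonbacktracking E L \<and> (\<exists>x R. L = p x # x # R \<and> p (p x) \<noteq> x)}"
    have "[p v, v] \<in> ?Q" using v edge by (auto simp: insert_commute)
    then show False
    proof (rule no_unbounded_nonbacktracking[OF E])
      fix L assume "L \<in> ?Q"
      then show "nonbacktracking E L" by simp
    next
      fix L assume "L \<in> ?Q"
      then obtain x R where L: "L = p x # x # R" "nonbacktracking E L" "p (p x) \<noteq> x" by blast
      then have "p (p x) # L \<in> ?Q" using edge[of "p x"] inj by (auto simp: insert_commute)
      then show "\<exists>K\<in>?Q. length L < length K" by (rule bexI[rotated]) simp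
    qed
  qed
  then show ?thesis using that edge by (auto simp: matching_involution_def)
qed

section \<open>Alternating paths and the inverse graph\<close>

text \<open>
  Like the walks above, these paths grow at the head. They start at \<open>b\<close>, and both the first and the last
  edge are matching edges.
\<close>

inductive alternating :: "'v graph \<Rightarrow> ('v \<Rightarrow> 'v) \<Rightarrow> 'v \<Rightarrow> 'v list \<Rightarrow> bool" for E \<phi> b where
  start: "alternating E \<phi> b [\<phi> b, b]"
| extend: "alternating E \<phi> b (d # R) \<Longrightarrow> {d, y} \<in> E \<Longrightarrow> y \<noteq> \<phi> d
    \<Longrightarrow> alternating E \<phi> b (\<phi> y # y # d # R)"

lemma alternating_mono: "alternating E \<phi> b L \<Longrightarrow> E \<subseteq> F \<Longrightarrow> alternating F \<phi> b L"
  by (induction rule: alternating.induct) (auto intro: alternating.intros)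

lemma alternating_last: "alternating E \<phi> b L \<Longrightarrow> \<exists>K. L = K @ [\<phi> b, b]"
proof (induction rule: alternating.induct)
  case start
  show ?case by (rule exI[of _ "[]"]) simp
next
  case (extend d R y)
  then obtain K where "d # R = K @ [\<phi> b, b]" by blast
  then show ?case by (intro exI[of _ "\<phi> y # y # K"]) simp
qed

lemma alternating_first:
  assumes "alternating E \<phi> b L" "matching_involution E \<phi>"
  shows "\<exists>x R. L = x # \<phi> x # R"
  using assms(1) by (rule alternating.cases) (use assms(2) in \<open>auto simp: matching_involution_def\<close>)

lemma alternating_nonbacktracking:
  assumes "alternating E \<phi> b L" "matching_involution E \<phi>"
  shows "nonbacktracking E L"
  using assms(1)
proof (induction rule: alternating.induct)
  case start
  have "{b, \<phi> b} \<in> E" using assms(2) by (simp add: matching_involution_def)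
  then show ?case by (simp add: insert_commute)
next
  case (extend d R y)
  have inv: "\<And>v. \<phi> (\<phi> v) = v" and edge: "\<And>v. {v, \<phi> v} \<in> E"
    using assms(2) by (auto simp: matching_involution_def)
  obtain R' where "R = \<phi> d # R'"
    using alternating_first[OF extend.hyps(1) assms(2)] by auto
  moreover have "\<phi> y \<noteq> d" using extend.hyps(3) inv by metis
  moreover have "nonbacktracking E (d # R)" by (rule extend.IH)
  ultimately show ?case using extend.hyps edge[of y] by (simp add: insert_commute)
qed

lemma alternating_joined:
  assumes "alternating E \<phi> b L" "matching_involution E \<phi>" "w \<in> set L"
  shows "(b, w) \<in> joined E"
proof -
  have edge: "\<And>v. (v, \<phi> v) \<in> joined E"
    using assms(2) by (auto simp: matching_involution_def intro: joined_edge)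
  show ?thesis using assms(1,3)
  proof (induction arbitrary: w rule: alternating.induct)
    case start
    then show ?case using edge by auto
  next
    case (extend d R y)
    have "(b, d) \<in> joined E" by (rule extend.IH) simp
    then have y: "(b, y) \<in> joined E" by (rule joined_trans) (rule joined_edge[OF extend.hyps(2)])
    then have "(b, \<phi> y) \<in> joined E" using edge by (rule joined_trans)
    then show ?case using y extend.IH extend.prems by auto
  qed
qed

text \<open>
  Here \<open>z\<close> is column \<open>b\<close> of the inverse matrix. It is nonzero at \<open>\<phi> b\<close> because the values at the
  neighbours of \<open>b\<close> sum to 1 and those off the matching edge vanish. If it is nonzero at the end \<open>d\<close>
  of an alternating path and \<open>y\<close> is a further non-matching neighbour of \<open>d\<close>, the values at the neighbours
  of \<open>y\<close> sum to 0 and those at neighbours other than \<open>d\<close> and \<open>\<phi> y\<close> vanish, so \<open>\<phi> y\<close> has to balance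
  \<open>d\<close>. The vanishing is \<open>support_not_escaping\<close>, applied to the path leading back to \<open>b\<close>.
\<close>

lemma inverse_entry_nonzero:
  fixes E :: "'v::finite graph" and z :: "'v \<Rightarrow> real"
  assumes E: "forest E" and \<phi>: "matching_involution E \<phi>"
    and rows: "\<And>r. (\<Sum>w | {r, w} \<in> E. z w) = (if r = b then 1 else 0)"
    and L: "alternating E \<phi> b L"
  shows "z (hd L) \<noteq> 0"
proof -
  have inv: "\<And>v. \<phi> (\<phi> v) = v" and edge: "\<And>v. {v, \<phi> v} \<in> E"
    using \<phi> by (auto simp: matching_involution_def)
  have rows0: "(\<Sum>w | {r, w} \<in> E. z w) = 0" if "r \<noteq> b" for r
    using rows[of r] that by simp
  have vanishing: "z c = 0" if "nonbacktracking E (\<phi> c # c # R)" "b \<in> set (c # R)" for c R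
    by (rule support_not_escaping[OF E \<phi> _ that]) (rule rows0)
  show ?thesis using L
  proof (induction rule: alternating.induct)
    case start
    have "(\<Sum>w | {b, w} \<in> E. z w) \<noteq> 0" using rows by simp
    then obtain c where c: "{b, c} \<in> E" "z c \<noteq> 0"
      by (metis (mono_tags, lifting) mem_Collect_eq sum.neutral)
    have "c = \<phi> b"
    proof (rule ccontr)
      assume "c \<noteq> \<phi> b"
      then have "\<phi> c \<noteq> b" using inv by metis
      then have "nonbacktracking E (\<phi> c # c # [b])"
        using c(1) edge[of c] by (simp add: insert_commute)
      then have "z c = 0" by (rule vanishing) simp
      with c(2) show False by simp
    qed
    then show ?case using c by simp
  next
    case (extend d R y)
    have nb: "nonbacktracking E (\<phi> y # y # d # R)"
      by (rule alternating_nonbacktracking[OF alternating.extend[OF extend.hyps] \<phi>])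
    obtain K where "d # R = K @ [\<phi> b, b]" using alternating_last[OF extend.hyps(1)] by blast
    then have b: "b \<in> set (d # R)" by simp
    have "distinct (y # d # R)"
      using nonbacktracking_distinct[OF E nb] by auto
    then have "y \<noteq> b" using b by auto
    then have "(\<Sum>w | {y, w} \<in> E. z w) = 0" using rows by simp
    then obtain c where c: "{y, c} \<in> E" "c \<noteq> d" "z c \<noteq> 0"
      using other_nonzero_neighbour[of z y E d] extend.hyps(2) extend.IH
      by (metis insert_commute list.sel(1))
    have "c = \<phi> y"
    proof (rule ccontr)
      assume "c \<noteq> \<phi> y"
      then have "\<phi> c \<noteq> y" using inv by metis
      then have "nonbacktracking E (\<phi> c # c # y # d # R)"
        using c nb edge[of c] by (auto simp: insert_commute)
      then have "z c = 0" by (rule vanishing) (use b in simp)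
      with c(3) show False by simp
    qed
    then show ?case using c by simp
  qed
qed

lemma alternating_in_inverse_graph:
  fixes E :: "'v::finite graph"
  assumes E: "forest E" and \<phi>: "matching_involution E \<phi>"
    and L: "alternating E \<phi> b L" and "hd L \<noteq> b"
  shows "{b, hd L} \<in> inverse_graph E"
proof -
  let ?A = "adjacency_matrix E"
  have "invertible ?A" using invertible_if_matching_involution[OF E \<phi>] .
  then have "?A ** matrix_inv ?A = mat 1"
    unfolding invertible_def matrix_inv_def by (rule someI_ex[THEN conjunct1])
  then have "(\<Sum>w\<in>UNIV. ?A $ r $ w * matrix_inv ?A $ w $ b) = (if r = b then 1 else 0)" for r
    by (simp add: matrix_matrix_mult_def mat_def vec_eq_iff)
  then have "(\<Sum>w | {r, w} \<in> E. matrix_inv ?A $ w $ b) = (if r = b then 1 else 0)" for r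
    by (simp add: adjacency_matrix_row)
  then have "matrix_inv ?A $ hd L $ b \<noteq> 0"
    using inverse_entry_nonzero[OF E \<phi> _ L, of "\<lambda>w. matrix_inv ?A $ w $ b"] by simp
  then show ?thesis using assms(4) unfolding inverse_graph_def by (auto simp: insert_commute)
qed

lemma maximal_alternating:
  fixes E :: "'v::finite graph"
  assumes E: "forest E" and \<phi>: "matching_involution E \<phi>"
  obtains x R where "alternating E \<phi> b (x # R)" "\<And>y. {x, y} \<in> E \<Longrightarrow> y = \<phi> x"
proof (rule ccontr)
  assume no: "\<not> thesis"
  let ?Q = "{L. alternating E \<phi> b L}"
  have "[\<phi> b, b] \<in> ?Q" by (simp add: alternating.start)
  then show False
  proof (rule no_unbounded_nonbacktracking[OF E])
    fix L assume "L \<in> ?Q"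
    then show "nonbacktracking E L" using alternating_nonbacktracking[OF _ \<phi>] by blast
  next
    fix L assume "L \<in> ?Q"
    then have L: "alternating E \<phi> b L" by simp
    then obtain x R where R: "L = x # R" using alternating_first[OF _ \<phi>] by blast
    with L no that obtain y where "{x, y} \<in> E" "y \<noteq> \<phi> x" by metis
    then have "\<phi> y # y # L \<in> ?Q" using L R by (simp add: alternating.extend)
    then show "\<exists>K\<in>?Q. length L < length K" by (rule bexI[rotated]) simp
  qed
qed

section \<open>Isomorphism and the number of leaves\<close>

lemma isomorphic_refl: "isomorphic E E"
  unfolding isomorphic_def by (rule exI[of _ id]) auto

lemma isomorphic_card_leaves:
  fixes E F :: "'v::finite graph"
  assumes "isomorphic E F"
  shows "card {w. vertex_degree E w = 1} = card {w. vertex_degree F w = 1}"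
proof -
  obtain h where h: "bij h" and F: "F = (\<lambda>e. h ` e) ` E"
    using assms by (auto simp: isomorphic_def)
  have inj: "inj h" using h by (rule bij_is_inj)
  have mem: "{h a, h b} \<in> F \<longleftrightarrow> {a, b} \<in> E" for a b
  proof -
    have "{h a, h b} = h ` e \<longleftrightarrow> {a, b} = e" for e
      using inj_image_eq_iff[OF inj, of "{a, b}" e] by simp
    then show ?thesis unfolding F image_iff by simp
  qed
  have "{w. {h v, w} \<in> F} = h ` {w. {v, w} \<in> E}" for v
    using mem bij_is_surj[OF h] by (auto simp: image_iff) (metis surjD)
  then have deg: "vertex_degree F (h v) = vertex_degree E v" for v
    unfolding vertex_degree_def by (simp add: card_image inj_on_subset[OF inj])
  have "{w. vertex_degree F w = 1} = h ` {w. vertex_degree E w = 1}"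
    using deg bij_is_surj[OF h] by (auto simp: image_iff) (metis surjD)
  then show ?thesis by (simp add: card_image inj_on_subset[OF inj])
qed

section \<open>Moving a branch to another vertex\<close>

text \<open>
  Cutting \<open>uv\<close> separates the tree into the component of \<open>u\<close>, which contains \<open>x\<close>, and that of \<open>v\<close>; the
  new edge reconnects the two components, so it is a bridge and creates no cycle.
\<close>

lemma tree_replace_edge:
  assumes T: "tree T" and uv: "{u, v} \<in> T" and ux: "(u, x) \<in> joined (T - {{u, v}})"
  shows "tree (insert {x, v} (T - {{u, v}}))" and "(x, v) \<notin> joined (T - {{u, v}})"
proof -
  let ?T = "T - {{u, v}}" and ?S = "insert {x, v} (T - {{u, v}})"
  have simple: "simple_graph T" and conn: "connected_graph T" and forest: "forest T"
    using T by (auto simp: tree_def forest_def)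
  have nuv: "(u, v) \<notin> joined ?T"
    using forest uv forest_iff_bridges[OF simple] by blast
  then show nxv: "(x, v) \<notin> joined ?T"
    using ux by (meson joined_trans)
  then have "x \<noteq> v" by auto
  then have S: "simple_graph ?S" using simple by (auto simp: simple_graph_def)
  have uvS: "(u, v) \<in> joined ?S"
    using joined_mono[OF ux, of ?S] joined_edge[of x v ?S] by (meson insertI1 joined_trans subset_insertI)
  have connS: "(a, b) \<in> joined ?S" for a b
  proof -
    have "(a, b) \<in> joined (insert {u, v} ?T)"
      using conn uv by (simp add: connected_graph_def insert_absorb joined_def)
    then have "(a, b) \<in> joined ?T \<or> (a, u) \<in> joined ?T \<and> (v, b) \<in> joined ?T
         \<or> (a, v) \<in> joined ?T \<and> (u, b) \<in> joined ?T"
      by (rule joined_insert)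
    then show ?thesis
      using joined_mono[of _ _ ?T ?S] uvS joined_sym[OF uvS]
      by (meson joined_trans subset_insertI)
  qed
  have "(s, t) \<notin> joined (?S - {{s, t}})" if st: "{s, t} \<in> ?S" for s t
  proof
    assume j: "(s, t) \<in> joined (?S - {{s, t}})"
    show False
    proof (cases "{s, t} = {x, v}")
      case True
      then have "?S - {{s, t}} \<subseteq> ?T" by auto
      with j have "(s, t) \<in> joined ?T" by (rule joined_mono)
      then show False using True nxv joined_sym[of s t ?T] by (auto simp: doubleton_eq_iff)
    next
      case False
      let ?R = "?T - {{s, t}}"
      have "?S - {{s, t}} = insert {x, v} ?R" using False by auto
      then have "(s, t) \<in> joined ?R \<or> (s, x) \<in> joined ?R \<and> (v, t) \<in> joined ?R
         \<or> (s, v) \<in> joined ?R \<and> (x, t) \<in> joined ?R"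
        using j joined_insert[of s t x v ?R] by simp
      moreover have "(s, t) \<notin> joined ?R"
      proof -
        have "{s, t} \<in> T" using st False by auto
        then have "(s, t) \<notin> joined (T - {{s, t}})"
          using forest forest_iff_bridges[OF simple] by blast
        then show ?thesis using joined_mono[of s t ?R "T - {{s, t}}"] by blast
      qed
      ultimately have "(s, x) \<in> joined ?T \<and> (v, t) \<in> joined ?T
         \<or> (s, v) \<in> joined ?T \<and> (x, t) \<in> joined ?T"
        using joined_mono[of _ _ ?R ?T, OF _ Diff_subset] by blast
      moreover have "(s, t) \<in> joined ?T" using st False by (intro joined_edge) auto
      ultimately show False using nxv by (meson joined_sym joined_trans)
    qed
  qed
  then have "forest ?S" using forest_iff_bridges[OF S] by blast
  then show "tree ?S" using connS by (auto simp: tree_def forest_def connected_graph_def joined_def)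
qed

text \<open>
  Here \<open>E\<close> plays the role of the forest left after cutting \<open>uv\<close>. The cycle runs from \<open>v\<close> to \<open>x\<close>, back along
  the alternating path to \<open>u\<close>, and along \<open>uv\<close> to \<open>v\<close>; the first vertex \<open>\<phi> u\<close> of the path is left out.
\<close>

lemma alternating_cycle:
  assumes E: "forest E" and \<phi>: "matching_involution E \<phi>"
    and L: "alternating E \<phi> (\<phi> u) (x # R)" and xu: "x \<noteq> u" and v: "v \<notin> set (x # R)"
  shows "on_fundamental_cycle (insert {x, v} E) {u, v} {x, v}"
proof -
  have inv: "\<And>v. \<phi> (\<phi> v) = v" using \<phi> by (auto simp: matching_involution_def)
  obtain K where K: "x # R = K @ [u, \<phi> u]"
    using alternating_last[OF L] inv by auto
  then obtain K' where K': "K = x # K'" using xu by (cases K) auto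
  let ?p = "v # K @ [u]" and ?F = "insert {u, v} (insert {x, v} E)"
  have nb: "nonbacktracking E ((K @ [u]) @ [\<phi> u])" using alternating_nonbacktracking[OF L \<phi>] K by simp
  have "distinct ((K @ [u]) @ [\<phi> u])" using nonbacktracking_distinct[OF E nb] .
  then have "distinct ?p" using v K by auto
  moreover have "successively (\<lambda>a b. {a, b} \<in> E) (K @ [u])"
    using nonbacktracking_successively[OF nb] unfolding successively_append_iff by blast
  then have "successively (\<lambda>a b. {a, b} \<in> ?F) (K @ [u])"
    by (rule successively_mono) auto
  then have "successively (\<lambda>a b. {a, b} \<in> ?F) ?p"
    using K' by (auto simp: insert_commute)
  ultimately have "is_cycle ?F ?p" using K' by (intro cycle_of_closed_path) auto
  moreover have "{x, v} \<in> cycle_edges ?p"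
    unfolding cycle_edges_def using K' by (auto intro!: exI[of _ 0] simp: insert_commute)
  ultimately show ?thesis unfolding on_fundamental_cycle_def by blast
qed

theorem lemma6p1:
  fixes n :: nat and T :: "'v::finite graph"
  assumes "n \<ge> 1"
    and "minimal_tree n T"
  shows "\<not> (\<exists>v. vertex_degree T v \<ge> 3)"
proof
  assume "\<exists>v. vertex_degree T v \<ge> 3"
  then obtain u where u: "vertex_degree T u \<ge> 3" by blast
  have T: "T \<in> invertible_trees n"
    and minimal: "\<And>S. S \<in> invertible_trees n \<Longrightarrow> leq_t n S T \<Longrightarrow> isomorphic S T"
    using assms(2) by (auto simp: minimal_tree_def)
  then have tree: "tree T" and forest: "forest T" and simple: "simple_graph T"
    and invertible: "invertible (adjacency_matrix T)" and card: "CARD('v) = 2 * n"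
    by (auto simp: invertible_trees_def tree_def forest_def)
  obtain \<phi> where \<phi>: "matching_involution T \<phi>"
    using matching_involution_if_invertible[OF forest invertible] .
  then have inv: "\<And>v. \<phi> (\<phi> v) = v" and edge: "\<And>v. {v, \<phi> v} \<in> T"
    by (auto simp: matching_involution_def)
  \<comment> \<open>Used twice: with \<open>\<phi> u\<close> in place of \<open>v\<close> it yields \<open>v\<close>, and then with \<open>v\<close> it yields \<open>a\<close>.\<close>
  have other: "\<exists>a. {u, a} \<in> T \<and> a \<noteq> \<phi> u \<and> a \<noteq> v" for v
  proof (rule ccontr)
    assume "\<not> ?thesis"
    then have "{w. {u, w} \<in> T} \<subseteq> {\<phi> u, v}" by blast
    then have "vertex_degree T u \<le> card {\<phi> u, v}"
      unfolding vertex_degree_def by (intro card_mono) auto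
    also have "\<dots> \<le> 2" by (simp add: card_insert_if)
    finally show False using u by simp
  qed
  obtain v where v: "{u, v} \<in> T" "v \<noteq> \<phi> u" using other[of "\<phi> u"] by blast
  obtain a where a: "{u, a} \<in> T" "a \<noteq> \<phi> u" "a \<noteq> v" using other[of v] by blast
  let ?T = "T - {{u, v}}"
  have \<phi>': "matching_involution ?T \<phi>"
    using inv edge v(2) by (auto simp: matching_involution_def doubleton_eq_iff)
  have forest': "forest ?T"
    using forest by (auto simp: forest_def simple_graph_def is_cycle_def)
  obtain x R where x: "alternating ?T \<phi> (\<phi> u) (x # R)"
    and last: "\<And>y. {x, y} \<in> ?T \<Longrightarrow> y = \<phi> x"
    using maximal_alternating[OF forest' \<phi>'] by blast
  have joined: "(u, w) \<in> joined ?T" if "w \<in> set (x # R)" for w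
  proof (rule joined_trans)
    show "(u, \<phi> u) \<in> joined ?T" using \<phi>' by (simp add: matching_involution_def joined_edge)
    show "(\<phi> u, w) \<in> joined ?T" by (rule alternating_joined[OF x \<phi>' that])
  qed
  \<comment> \<open>The tree below \<open>T\<close>: the branch at \<open>v\<close> now hangs on the leaf \<open>x\<close>.\<close>
  let ?S = "insert {x, v} ?T"
  have treeS: "tree ?S" and "(x, v) \<notin> joined ?T"
    using tree_replace_edge[OF tree v(1) joined[of x]] by auto
  have off: "v \<notin> set (x # R)"
  proof
    assume "v \<in> set (x # R)"
    from tree_replace_edge(2)[OF tree v(1) joined[OF this]] show False by simp
  qed
  have "{u, a} \<in> ?T" using a by (auto simp: doubleton_eq_iff)
  then have "x \<noteq> u" using last a(2) by blast
  have "x \<noteq> v" using off by auto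
  have "{x, v} \<notin> ?T" using \<open>(x, v) \<notin> joined ?T\<close> by (rule contrapos_nn) (rule joined_edge)
  then have xvT: "{x, v} \<notin> T" using \<open>x \<noteq> u\<close> \<open>x \<noteq> v\<close> by (auto simp: doubleton_eq_iff)
  have "{u, v} \<notin> ?S" using \<open>x \<noteq> u\<close> \<open>x \<noteq> v\<close> by (auto simp: doubleton_eq_iff)

  have forestS: "forest ?S" using treeS by (auto simp: tree_def forest_def)
  have \<phi>S: "matching_involution ?S \<phi>" using \<phi>' by (auto simp: matching_involution_def)
  note mateS = matching_of_involution[OF forestS \<phi>S]
  have S: "?S \<in> invertible_trees n"
    using treeS card invertible_if_matching_involution[OF forestS \<phi>S]
    by (simp add: invertible_trees_def)
  have image: "\<phi> ` {\<phi> u, \<phi> v} = {u, v}" by (simp add: inv)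

  have "tree_exchange ?S T"
    unfolding tree_exchange_def mateS(2)
  proof (intro exI conjI)
    \<comment> \<open>The edge \<open>xv\<close> is non-matching, so the path may be prolonged by \<open>v\<close> and \<open>\<phi> v\<close>.\<close>
    have "v \<noteq> \<phi> x"
      using edge[of x] xvT by auto
    then have "alternating ?S \<phi> (\<phi> u) (\<phi> v # v # x # R)"
      by (intro alternating.extend alternating_mono[OF x]) auto
    moreover have "\<phi> v \<noteq> \<phi> u" using v(1) simple_graph_ends[OF simple] inv by metis
    ultimately show "{\<phi> u, \<phi> v} \<in> inverse_graph ?S"
      using alternating_in_inverse_graph[OF forestS \<phi>S, of "\<phi> u" "\<phi> v # v # x # R"] by simp
    show "{\<phi> u, \<phi> v} \<notin> mate_tree ?S"
    proof
      assume "{\<phi> u, \<phi> v} \<in> mate_tree ?S"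
      then obtain g where g: "g \<in> ?S" "{\<phi> u, \<phi> v} = \<phi> ` g"
        unfolding mate_tree_def mateS(2) by blast
      then have "g = {u, v}" using image inv by (simp add: image_image)
      then show False using g(1) \<open>{u, v} \<notin> ?S\<close> by blast
    qed
    show "{x, v} \<in> ?S" by simp
    show "{x, v} \<notin> matching ?S"
      unfolding mateS(1) using xvT edge by auto
    show "on_fundamental_cycle ?S (\<phi> ` {\<phi> u, \<phi> v}) {x, v}"
      unfolding image using alternating_cycle[OF forest' \<phi>' x \<open>x \<noteq> u\<close> off] .
    show "T = exchange ?S {\<phi> u, \<phi> v} {x, v}"
      unfolding exchange_def mateS(2) image using v(1) xvT by auto
  qed
  then have "exchange_step n ?S T"
    using S T isomorphic_refl unfolding exchange_step_def by blast
  then have "isomorphic ?S T"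
    using minimal[OF S] unfolding leq_t_def by blast

  moreover have "{w. vertex_degree ?S w = 1} \<subset> {w. vertex_degree T w = 1}"
  proof -
    have "{w. {x, w} \<in> T} = {\<phi> x}"
      using last edge \<open>x \<noteq> u\<close> \<open>x \<noteq> v\<close> by (auto simp: doubleton_eq_iff)
    then have xT: "vertex_degree T x = 1" by (simp add: vertex_degree_def)
    have "{w. {x, w} \<in> ?S} = {\<phi> x, v}"
      using last \<phi>' by (auto simp: matching_involution_def doubleton_eq_iff)
    moreover have "\<phi> x \<noteq> v" using edge[of x] xvT by auto
    ultimately have xS: "vertex_degree ?S x \<noteq> 1" by (simp add: vertex_degree_def)
    have "{\<phi> u, a} \<subseteq> {w. {u, w} \<in> ?S}"
      using \<open>{u, a} \<in> ?T\<close> \<phi>' by (auto simp: matching_involution_def)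
    then have "card {\<phi> u, a} \<le> vertex_degree ?S u"
      unfolding vertex_degree_def by (intro card_mono) auto
    then have uS: "vertex_degree ?S u \<noteq> 1" using a(2) by auto
    have "{w. {v, w} \<in> ?S} = insert x ({w. {v, w} \<in> T} - {u})"
      using \<open>x \<noteq> v\<close> by (auto simp: doubleton_eq_iff insert_commute)
    moreover have "x \<notin> {w. {v, w} \<in> T}" "u \<in> {w. {v, w} \<in> T}"
      using xvT v(1) by (auto simp: insert_commute)
    ultimately have "vertex_degree ?S v = vertex_degree T v"
      unfolding vertex_degree_def
      by (metis (no_types, lifting) Diff_iff card_Suc_Diff1 card_insert_disjoint finite)
    moreover have "vertex_degree ?S w = vertex_degree T w" if "w \<noteq> u" "w \<noteq> v" "w \<noteq> x" for w
    proof -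
      have "{y. {w, y} \<in> ?S} = {y. {w, y} \<in> T}" using that by (auto simp: doubleton_eq_iff)
      then show ?thesis by (simp add: vertex_degree_def)
    qed
    ultimately have "vertex_degree T w = 1" if "vertex_degree ?S w = 1" for w
      using that xS uS by metis
    then show ?thesis using xT xS by blast
  qed
  then have "card {w. vertex_degree ?S w = 1} < card {w. vertex_degree T w = 1}"
    by (intro psubset_card_mono) auto
  ultimately show False using isomorphic_card_leaves by fastforce
qed

end
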